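(* Let $k$ be a positive integer and let $A,B\in\mathcal{B}(\mathcal{H})$ be doubly commuting $k$-quasihyponormal operators. Then $AB$ is $k$-quasihyponormal.
   Context: $\mathcal{H}$ is a complex Hilbert space and $\mathcal{B}(\mathcal{H})$ is the set of bounded linear operators on $\mathcal{H}$. Operators $A,B$ are doubly commuting (doubly commutative) if $AB=BA$ and $AB^*=B^*A$. For a positive integer $k$, $T\in\mathcal{B}(\mathcal{H})$ is $k$-quasihyponormal if $T^{*k}(T^*T-TT^* )T^k\geq 0$, equivalently $\|T^*T^kx\|\leq\|T^{k+1}x\|$ for all $x\in\mathcal{H}$. *)

theory Defs
  imports "HOL-Analysis.Analysis" "HOL-Library.Nonpos_Ints"
begin

text \<open>
  Complex Hilbert spaces as a type class. Metric, topology and completeness are inherited from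
  \<^class>\<open>banach\<close>; the first axiom makes the real scalar multiplication the restriction of the
  complex one, and the last one makes the norm the one induced by the inner product, so no
  structure beyond the complex Hilbert space is assumed. The inner product is linear in its first
  and conjugate-linear in its second argument.
\<close>

class chilbert_space = banach +
  fixes scaleC :: "complex \<Rightarrow> 'a \<Rightarrow> 'a" (infixr "*\<^sub>C" 75)
    and cinner :: "'a \<Rightarrow> 'a \<Rightarrow> complex"
  assumes scaleR_scaleC: "r *\<^sub>R x = complex_of_real r *\<^sub>C x"
    and scaleC_add_right: "c *\<^sub>C (x + y) = c *\<^sub>C x + c *\<^sub>C y"
    and scaleC_add_left: "(c + d) *\<^sub>C x = c *\<^sub>C x + d *\<^sub>C x"
    and scaleC_scaleC: "c *\<^sub>C d *\<^sub>C x = (c * d) *\<^sub>C x"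
    and scaleC_one: "1 *\<^sub>C x = x"
    and cinner_commute: "cinner x y = cnj (cinner y x)"
    and cinner_add_left: "cinner (x + y) z = cinner x z + cinner y z"
    and cinner_scaleC_left: "cinner (c *\<^sub>C x) y = c * cinner x y"
    and cinner_self_nonneg: "cinner x x \<in> \<real>\<^sub>\<ge>\<^sub>0"
    and cinner_eq_zero_iff: "cinner x x = 0 \<longleftrightarrow> x = 0"
    and norm_eq_sqrt_cinner: "norm x = sqrt (Re (cinner x x))"

instantiation complex :: chilbert_space
begin

definition scaleC_complex :: "complex \<Rightarrow> complex \<Rightarrow> complex"
  where "scaleC_complex c x = c * x"

definition cinner_complex :: "complex \<Rightarrow> complex \<Rightarrow> complex"
  where "cinner_complex x y = x * cnj y"

instance
proof
  fix x y z c d :: complex and r :: real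
  show "r *\<^sub>R x = complex_of_real r *\<^sub>C x"
    by (simp add: scaleC_complex_def scaleR_conv_of_real)
  show "c *\<^sub>C (x + y) = c *\<^sub>C x + c *\<^sub>C y" "(c + d) *\<^sub>C x = c *\<^sub>C x + d *\<^sub>C x"
    "c *\<^sub>C d *\<^sub>C x = (c * d) *\<^sub>C x" "1 *\<^sub>C x = x"
    by (simp_all add: scaleC_complex_def distrib_left distrib_right)
  show "cinner x y = cnj (cinner y x)" "cinner (x + y) z = cinner x z + cinner y z"
    "cinner (c *\<^sub>C x) y = c * cinner x y" "cinner x x = 0 \<longleftrightarrow> x = 0"
    by (simp_all add: scaleC_complex_def cinner_complex_def distrib_right)
  have self: "cinner x x = complex_of_real ((norm x)\<^sup>2)"
    unfolding cinner_complex_def by (simp only: complex_norm_square)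
  show "cinner x x \<in> \<real>\<^sub>\<ge>\<^sub>0"
    unfolding self nonneg_Reals_of_real_iff by (rule zero_le_power2)
  show "norm x = sqrt (Re (cinner x x))"
    unfolding self Re_complex_of_real by simp
qed

end

definition bounded_clinear :: "('a::chilbert_space \<Rightarrow> 'a) \<Rightarrow> bool"
  where "bounded_clinear T \<longleftrightarrow> bounded_linear T \<and> (\<forall>c x. T (c *\<^sub>C x) = c *\<^sub>C T x)"

text \<open>
  The Hilbert space adjoint. It exists and is unique for every bounded operator (Riesz
  representation); for other functions the value is unspecified.
\<close>

definition hadjoint :: "('a::chilbert_space \<Rightarrow> 'a) \<Rightarrow> 'a \<Rightarrow> 'a"
  where "hadjoint T =
    (THE S. bounded_clinear S \<and> (\<forall>x y. cinner (T x) y = cinner x (S y)))"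

definition positive_operator :: "('a::chilbert_space \<Rightarrow> 'a) \<Rightarrow> bool"
  where "positive_operator P \<longleftrightarrow> (\<forall>x. cinner (P x) x \<in> \<real>\<^sub>\<ge>\<^sub>0)"

definition doubly_commuting :: "('a::chilbert_space \<Rightarrow> 'a) \<Rightarrow> ('a \<Rightarrow> 'a) \<Rightarrow> bool"
  where "doubly_commuting A B \<longleftrightarrow>
    A \<circ> B = B \<circ> A \<and> A \<circ> hadjoint B = hadjoint B \<circ> A"

definition quasihyponormal :: "nat \<Rightarrow> ('a::chilbert_space \<Rightarrow> 'a) \<Rightarrow> bool"
  where "quasihyponormal k T \<longleftrightarrow>
    bounded_clinear T \<and>
    positive_operator
      ((hadjoint T ^^ k) \<circ> (\<lambda>x. hadjoint T (T x) - T (hadjoint T x)) \<circ> (T ^^ k))"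

end

theory Submission
  imports Defs
begin

text \<open>
  In the norm form \<open>\<parallel>T\<^sup>* T\<^sup>k x\<parallel> \<le> \<parallel>T\<^sup>k\<^sup>+\<^sup>1 x\<parallel>\<close> of \<open>k\<close>-quasihyponormality, double
  commutation lets the two hypotheses be applied one after the other:
  \<open>\<parallel>(AB)\<^sup>* (AB)\<^sup>k x\<parallel> = \<parallel>A\<^sup>* A\<^sup>k (B\<^sup>* B\<^sup>k x)\<parallel> \<le> \<parallel>A\<^sup>k\<^sup>+\<^sup>1 (B\<^sup>* B\<^sup>k x)\<parallel> = \<parallel>B\<^sup>* B\<^sup>k (A\<^sup>k\<^sup>+\<^sup>1 x)\<parallel>
    \<le> \<parallel>B\<^sup>k\<^sup>+\<^sup>1 (A\<^sup>k\<^sup>+\<^sup>1 x)\<parallel> = \<parallel>(AB)\<^sup>k\<^sup>+\<^sup>1 x\<parallel>\<close>.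
  The equalities use \<open>(AB)\<^sup>* = (BA)\<^sup>* = A\<^sup>* B\<^sup>*\<close> and otherwise only move powers of \<open>A\<close> past
  powers of \<open>B\<close> and past \<open>B\<^sup>*\<close>.

  What remains is that adjoints exist, which is the Riesz representation theorem. Here it comes
  from a variational argument (\<open>riesz_representation_Re\<close>): a bounded real-linear functional
  \<open>\<phi>\<close> is represented by the minimiser of the strictly convex energy
  \<open>x \<mapsto> \<parallel>x\<parallel>\<^sup>2 / 2 - \<phi> x\<close>. Passing to real parts is harmless, since a complex-linear functional is
  determined by its real part.
\<close>

section \<open>Inner product and norm\<close>

lemma cinner_add_right: "cinner x (y + z) = cinner x y + cinner x z"
  for x :: "'a::chilbert_space"
  using arg_cong[OF cinner_add_left[of y z x], of cnj]
  by (simp only: complex_cnj_add cinner_commute[symmetric])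

lemma cinner_scaleC_right: "cinner x (c *\<^sub>C y) = cnj c * cinner x y"
  for x :: "'a::chilbert_space"
  using arg_cong[OF cinner_scaleC_left[of c y x], of cnj]
  by (simp only: complex_cnj_mult cinner_commute[symmetric])

lemma cinner_scaleR_left: "cinner (r *\<^sub>R x) y = of_real r * cinner x y"
  for x :: "'a::chilbert_space"
  by (simp add: scaleR_scaleC cinner_scaleC_left)

lemma cinner_scaleR_right: "cinner x (r *\<^sub>R y) = of_real r * cinner x y"
  for x :: "'a::chilbert_space"
  by (simp add: scaleR_scaleC cinner_scaleC_right)

lemma cinner_minus_left: "cinner (- x) y = - cinner x y"
  for x :: "'a::chilbert_space"
  using cinner_scaleR_left[of "-1" x y] by simp

lemma cinner_diff_left: "cinner (x - z) y = cinner x y - cinner z y"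
  for x :: "'a::chilbert_space"
  using cinner_add_left[of x "- z" y] by (simp add: cinner_minus_left)

lemma cinner_diff_right: "cinner x (y - z) = cinner x y - cinner x z"
  for x :: "'a::chilbert_space"
  using arg_cong[OF cinner_diff_left[of y z x], of cnj]
  by (simp only: complex_cnj_diff cinner_commute[symmetric])

lemma Re_cinner_commute: "Re (cinner x y) = Re (cinner y x)"
  for x :: "'a::chilbert_space"
  by (subst cinner_commute) simp

lemma cinner_self: "cinner x x = complex_of_real ((norm x)\<^sup>2)"
  for x :: "'a::chilbert_space"
proof -
  obtain r where r: "cinner x x = complex_of_real r" "r \<ge> 0"
    using cinner_self_nonneg[of x] by (auto elim: nonneg_Reals_cases)
  then show ?thesis
    by (simp add: norm_eq_sqrt_cinner)
qed

lemma norm_add_squared: "(norm (x + y))\<^sup>2 = (norm x)\<^sup>2 + 2 * Re (cinner x y) + (norm y)\<^sup>2"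
  for x :: "'a::chilbert_space"
proof -
  have sq: "(norm z)\<^sup>2 = Re (cinner z z)" for z :: 'a
    by (simp add: cinner_self)
  show ?thesis
    unfolding sq by (simp add: cinner_add_left cinner_add_right Re_cinner_commute[of y x])
qed

text \<open>As the norm already satisfies the triangle inequality, squaring that inequality and
  cancelling gives the Cauchy-Schwarz inequality.\<close>

lemma abs_Re_cinner_le: "\<bar>Re (cinner x y)\<bar> \<le> norm x * norm y"
  for x :: "'a::chilbert_space"
proof -
  have upper: "Re (cinner z y) \<le> norm z * norm y" for z
  proof -
    have "(norm (z + y))\<^sup>2 \<le> (norm z + norm y)\<^sup>2"
      by (intro power_mono norm_triangle_ineq) auto
    then show ?thesis
      by (simp add: norm_add_squared power2_sum)
  qed
  show ?thesis
    using upper[of x] upper[of "- x"] by (simp add: cinner_minus_left)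
qed

lemma cinner_ext_right: "y = z" if "\<And>x. cinner x y = cinner x z"
  for y z :: "'a::chilbert_space"
  using that[of "y - z"] cinner_eq_zero_iff[of "y - z"] by (simp add: cinner_diff_right)

section \<open>Riesz representation\<close>

lemma linear_coefficient_zero:
  fixes a b :: real
  assumes "\<And>t. 0 \<le> a * t\<^sup>2 + b * t"
  shows "b = 0"
proof (rule ccontr)
  assume "b \<noteq> 0"
  define c where "c = \<bar>a\<bar> + 1"
  have "c > 0" "a < c" by (auto simp: c_def)
  \<comment> \<open>\<open>- b / c\<close> is the nonzero root of \<open>c t\<^sup>2 + b t\<close>, and \<open>a < c\<close> pushes the value there below \<open>0\<close>\<close>
  have "a * (- b / c)\<^sup>2 + b * (- b / c) = (a - c) * (b / c)\<^sup>2"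
    using \<open>c > 0\<close> by (simp add: field_simps power2_eq_square)
  also have "\<dots> < 0"
    using \<open>a < c\<close> \<open>b \<noteq> 0\<close> \<open>c > 0\<close> by (intro mult_neg_pos) auto
  finally show False
    using assms[of "- b / c"] by simp
qed

text \<open>The parallelogram law makes every minimising sequence of the energy Cauchy, and at a
  minimiser the first variation vanishes in all directions, which is the claim.\<close>

lemma riesz_representation_Re:
  fixes \<phi> :: "'a::chilbert_space \<Rightarrow> real"
  assumes "bounded_linear \<phi>"
  shows "\<exists>u. \<forall>x. \<phi> x = Re (cinner x u)"
proof -
  interpret \<phi>: bounded_linear \<phi> by fact
  obtain K where K: "\<And>x. norm (\<phi> x) \<le> norm x * K"
    using \<phi>.bounded by blast
  define J where "J x = (norm x)\<^sup>2 / 2 - \<phi> x" for x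
  define m where "m = Inf (range J)"
  have "- K\<^sup>2 / 2 \<le> J x" for x
    using K[of x] zero_le_power2[of "norm x - K"]
    by (simp add: J_def power2_diff abs_le_iff field_simps)
  then have bdd: "bdd_below (range J)"
    by (rule bdd_belowI2)
  have m_le: "m \<le> J x" for x
    unfolding m_def by (intro cInf_lower bdd) auto
  have "\<exists>x. J x < m + inverse (real (Suc n))" for n
  proof -
    have "Inf (range J) < m + inverse (real (Suc n))"
      by (simp add: m_def)
    then show ?thesis
      using bdd by (subst (asm) cInf_less_iff) auto
  qed
  then obtain X where X: "\<And>n. J (X n) < m + inverse (real (Suc n))"
    by metis
  \<comment> \<open>parallelogram law, with \<open>m\<close> as a lower bound for \<open>J\<close> at the midpoint\<close>
  have gap: "(norm (x - y))\<^sup>2 \<le> 4 * ((J x - m) + (J y - m))" for x y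
  proof -
    have diff: "(norm (x - y))\<^sup>2 = (norm x)\<^sup>2 - 2 * Re (cinner x y) + (norm y)\<^sup>2"
      using norm_add_squared[of x "- y"] cinner_diff_right[of x 0 y] cinner_diff_right[of x y y]
      by simp
    have half: "(norm ((1/2) *\<^sub>R z))\<^sup>2 = (norm z)\<^sup>2 / 4" for z :: 'a
      by (simp add: power_divide)
    have "J ((1/2) *\<^sub>R (x + y)) = (norm (x + y))\<^sup>2 / 8 - (\<phi> x + \<phi> y) / 2"
      unfolding J_def half \<phi>.scaleR \<phi>.add by simp
    also have "\<dots> = (J x + J y) / 2 - (norm (x - y))\<^sup>2 / 8"
      unfolding diff norm_add_squared by (simp add: J_def field_simps)
    finally have "m \<le> (J x + J y) / 2 - (norm (x - y))\<^sup>2 / 8"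
      using m_le[of "(1/2) *\<^sub>R (x + y)"] by simp
    then show ?thesis
      by (simp add: field_simps)
  qed
  have "Cauchy X"
  proof (rule metric_CauchyI)
    fix e :: real assume "e > 0"
    then obtain M where M: "inverse (real (Suc M)) < e\<^sup>2 / 8"
      using reals_Archimedean[of "e\<^sup>2 / 8"] by auto
    have close: "J (X n) - m < e\<^sup>2 / 8" if "n \<ge> M" for n
    proof -
      have "inverse (real (Suc n)) \<le> inverse (real (Suc M))"
        using that by (intro le_imp_inverse_le) auto
      then show ?thesis using X[of n] M by linarith
    qed
    have "dist (X n) (X p) < e" if "n \<ge> M" "p \<ge> M" for n p
    proof (rule power2_less_imp_less)
      have "(dist (X n) (X p))\<^sup>2 \<le> 4 * ((J (X n) - m) + (J (X p) - m))"
        unfolding dist_norm by (rule gap)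
      also have "\<dots> < 4 * (e\<^sup>2 / 8 + e\<^sup>2 / 8)"
        by (intro mult_strict_left_mono add_strict_mono close that) simp
      finally show "(dist (X n) (X p))\<^sup>2 < e\<^sup>2"
        by simp
    qed (use \<open>e > 0\<close> in simp)
    then show "\<exists>M. \<forall>n\<ge>M. \<forall>p\<ge>M. dist (X n) (X p) < e" by blast
  qed
  then obtain u where u: "X \<longlonglongrightarrow> u"
    using Cauchy_convergent convergent_def by blast
  have "(\<lambda>n. J (X n)) \<longlonglongrightarrow> J u"
    unfolding J_def by (intro tendsto_intros \<phi>.tendsto u) auto
  moreover have "(\<lambda>n. m + inverse (real (Suc n))) \<longlonglongrightarrow> m + 0"
    by (intro tendsto_intros LIMSEQ_inverse_real_of_nat)
  ultimately have "J u \<le> m + 0"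
    by (rule LIMSEQ_le) (use X in \<open>auto intro: less_imp_le\<close>)
  then have minimum: "J u \<le> J x" for x
    using m_le[of x] by simp
  have "Re (cinner u y) - \<phi> y = 0" for y
  proof (rule linear_coefficient_zero)
    fix t :: real
    have "J (u + t *\<^sub>R y) = J u + ((norm y)\<^sup>2 / 2 * t\<^sup>2 + (Re (cinner u y) - \<phi> y) * t)"
      by (simp add: J_def norm_add_squared cinner_scaleR_right \<phi>.add \<phi>.scaleR
          power_mult_distrib field_simps)
    then show "0 \<le> (norm y)\<^sup>2 / 2 * t\<^sup>2 + (Re (cinner u y) - \<phi> y) * t"
      using minimum[of "u + t *\<^sub>R y"] by simp
  qed
  then show ?thesis
    by (metis Re_cinner_commute eq_iff_diff_eq_0)
qed

section \<open>Adjoints\<close>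

lemma bounded_clinear_imp_linear: "bounded_clinear T \<Longrightarrow> bounded_linear T"
  by (simp add: bounded_clinear_def)

lemma bounded_clinear_comp:
  assumes "bounded_clinear S" "bounded_clinear T"
  shows "bounded_clinear (S \<circ> T)"
  using assms bounded_linear_compose[of S T] by (auto simp: bounded_clinear_def o_def)

text \<open>Riesz representation of \<open>x \<mapsto> Re \<langle>T x, y\<rangle>\<close> gives the value at \<open>y\<close>; linearity follows from
  uniqueness of the representing vector, and the bound from
  \<open>\<parallel>S y\<parallel>\<^sup>2 = \<langle>T (S y), y\<rangle>\<close> by Cauchy-Schwarz.\<close>

lemma adjoint_exists:
  assumes "bounded_clinear T"
  shows "\<exists>S. bounded_clinear S \<and> (\<forall>x y. cinner (T x) y = cinner x (S y))"
proof -
  interpret T: bounded_linear T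
    using assms by (rule bounded_clinear_imp_linear)
  have TC: "T (c *\<^sub>C x) = c *\<^sub>C T x" for c x
    using assms by (simp add: bounded_clinear_def)
  obtain K where "K \<ge> 0" and K: "\<And>x. norm (T x) \<le> norm x * K"
    using T.nonneg_bounded by blast
  have "\<exists>u. \<forall>x. Re (cinner (T x) y) = Re (cinner x u)" for y
  proof (rule riesz_representation_Re, rule bounded_linear_intro)
    fix x
    have "\<bar>Re (cinner (T x) y)\<bar> \<le> norm (T x) * norm y"
      by (rule abs_Re_cinner_le)
    also have "\<dots> \<le> norm x * K * norm y"
      by (intro mult_right_mono K) auto
    finally show "norm (Re (cinner (T x) y)) \<le> norm x * (K * norm y)"
      by (simp add: mult.assoc)
  qed (simp_all add: T.add T.scaleR cinner_add_left cinner_scaleR_left)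
  then obtain S where S: "\<And>x y. Re (cinner (T x) y) = Re (cinner x (S y))"
    by metis
  have adj: "cinner (T x) y = cinner x (S y)" for x y
    \<comment> \<open>the imaginary part at \<open>x\<close> is minus the real part at \<open>\<i> x\<close>\<close>
    using S[of x y] S[of "\<i> *\<^sub>C x" y] by (simp add: TC cinner_scaleC_left complex_eq_iff)
  have add: "S (y + z) = S y + S z" for y z
    by (rule cinner_ext_right) (simp add: adj[symmetric] cinner_add_right)
  have scaleC: "S (c *\<^sub>C y) = c *\<^sub>C S y" for c y
    by (rule cinner_ext_right) (simp add: adj[symmetric] cinner_scaleC_right)
  have bound: "norm (S y) \<le> norm y * K" for y
  proof (cases "S y = 0")
    case False
    have "norm (S y) * norm (S y) = Re (cinner (T (S y)) y)"
      by (simp add: adj cinner_self power2_eq_square)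
    also have "\<dots> \<le> norm (T (S y)) * norm y"
      using abs_Re_cinner_le[of "T (S y)" y] by simp
    also have "\<dots> \<le> norm (S y) * K * norm y"
      by (intro mult_right_mono K) auto
    finally have "norm (S y) * norm (S y) \<le> norm (S y) * (norm y * K)"
      by (simp add: mult_ac)
    then show ?thesis
      using False by simp
  qed (use \<open>K \<ge> 0\<close> in simp)
  have "bounded_linear S"
    by (rule bounded_linear_intro[OF add _ bound]) (simp add: scaleR_scaleC scaleC)
  then show ?thesis
    using adj scaleC unfolding bounded_clinear_def by blast
qed

lemma hadjoint_eqI:
  assumes "bounded_clinear S" "\<And>x y. cinner (T x) y = cinner x (S y)"
  shows "hadjoint T = S"
  unfolding hadjoint_def
proof (rule the_equality)
  fix S' assume S': "bounded_clinear S' \<and> (\<forall>x y. cinner (T x) y = cinner x (S' y))"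
  show "S' = S"
  proof (rule ext, rule cinner_ext_right)
    fix x y
    have "cinner x (S' y) = cinner (T x) y"
      by (rule sym) (rule S'[THEN conjunct2, rule_format])
    then show "cinner x (S' y) = cinner x (S y)"
      by (simp only: assms(2))
  qed
qed (simp add: assms)

lemma
  assumes "bounded_clinear T"
  shows bounded_clinear_hadjoint: "bounded_clinear (hadjoint T)"
    and cinner_hadjoint_right: "cinner x (hadjoint T y) = cinner (T x) y"
proof -
  obtain S where S: "bounded_clinear S" "\<And>x y. cinner (T x) y = cinner x (S y)"
    using adjoint_exists[OF assms] by auto
  have "hadjoint T = S"
    by (rule hadjoint_eqI) (rule S)+
  with S show "bounded_clinear (hadjoint T)" "cinner x (hadjoint T y) = cinner (T x) y"
    by simp_all
qed

lemma cinner_hadjoint_left: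
  assumes "bounded_clinear T"
  shows "cinner (hadjoint T x) y = cinner x (T y)"
proof -
  have "cinner (hadjoint T x) y = cnj (cinner y (hadjoint T x))"
    by (rule cinner_commute)
  also have "\<dots> = cnj (cinner (T y) x)"
    by (simp only: cinner_hadjoint_right[OF assms])
  also have "\<dots> = cinner x (T y)"
    by (rule cinner_commute[symmetric])
  finally show ?thesis .
qed

lemma hadjoint_comp:
  assumes "bounded_clinear S" "bounded_clinear T"
  shows "hadjoint (S \<circ> T) = hadjoint T \<circ> hadjoint S"
proof (rule hadjoint_eqI)
  show "bounded_clinear (hadjoint T \<circ> hadjoint S)"
    by (rule bounded_clinear_comp; rule bounded_clinear_hadjoint; fact)
  show "cinner ((S \<circ> T) x) y = cinner x ((hadjoint T \<circ> hadjoint S) y)" for x y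
    by (simp only: comp_apply cinner_hadjoint_right[OF assms(1)] cinner_hadjoint_right[OF assms(2)])
qed

lemma cinner_hadjoint_funpow_left:
  assumes "bounded_clinear T"
  shows "cinner ((hadjoint T ^^ n) x) y = cinner x ((T ^^ n) y)"
proof (induction n arbitrary: y)
  case (Suc n)
  then show ?case
    by (simp only: funpow.simps comp_apply cinner_hadjoint_left[OF assms] funpow_swap1[of T])
qed simp

section \<open>Quasihyponormal operators\<close>

text \<open>Moving all adjoints to the other side, the quadratic form at \<open>x\<close> is
  \<open>\<parallel>T w\<parallel>\<^sup>2 - \<parallel>T\<^sup>* w\<parallel>\<^sup>2\<close> with \<open>w = T\<^sup>k x\<close>.\<close>

lemma quasihyponormal_iff_norm_le:
  assumes "bounded_clinear T"
  shows "quasihyponormal k T \<longleftrightarrow>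
    (\<forall>x. norm (hadjoint T ((T ^^ k) x)) \<le> norm (T ((T ^^ k) x)))"
proof -
  have form: "cinner ((hadjoint T ^^ k) (hadjoint T (T ((T ^^ k) x)) - T (hadjoint T ((T ^^ k) x)))) x
      = complex_of_real ((norm (T ((T ^^ k) x)))\<^sup>2 - (norm (hadjoint T ((T ^^ k) x)))\<^sup>2)"
    (is "cinner (_ (hadjoint T (T ?w) - _)) x = _") for x
  proof -
    have "cinner ((hadjoint T ^^ k) (hadjoint T (T ?w) - T (hadjoint T ?w))) x
        = cinner (hadjoint T (T ?w)) ?w - cinner (T (hadjoint T ?w)) ?w"
      by (simp only: cinner_hadjoint_funpow_left[OF assms] cinner_diff_left)
    also have "\<dots> = cinner (T ?w) (T ?w) - cinner (hadjoint T ?w) (hadjoint T ?w)"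
      by (simp only: cinner_hadjoint_left[OF assms] cinner_hadjoint_right[OF assms])
    finally show ?thesis
      by (simp add: cinner_self)
  qed
  show ?thesis
    using assms
    by (simp add: quasihyponormal_def positive_operator_def form
        nonneg_Reals_of_real_iff abs_le_square_iff[symmetric] del: of_real_diff)
qed

lemma funpow_commute_apply:
  assumes "\<And>x. f (g x) = g (f x)"
  shows "(f ^^ n) (g x) = g ((f ^^ n) x)"
  by (induction n) (simp_all add: assms)

lemma funpow_comp_apply:
  assumes "\<And>x. f (g x) = g (f x)"
  shows "((f \<circ> g) ^^ n) x = (f ^^ n) ((g ^^ n) x)"
  by (induction n) (simp_all add: funpow_commute_apply[of f g, OF assms])

theorem proposition2p3:
  fixes A B :: "'h::chilbert_space \<Rightarrow> 'h" and k :: nat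
  assumes "k > 0"
    and "bounded_clinear A" and "bounded_clinear B"
    and "doubly_commuting A B"
    and "quasihyponormal k A" and "quasihyponormal k B"
  shows "quasihyponormal k (A \<circ> B)"
proof -
  note A = \<open>bounded_clinear A\<close> and B = \<open>bounded_clinear B\<close>
  have AB: "A \<circ> B = B \<circ> A" and AB': "A (hadjoint B x) = hadjoint B (A x)" for x
    using \<open>doubly_commuting A B\<close> by (simp_all add: doubly_commuting_def fun_eq_iff)
  have AB_apply: "A (B x) = B (A x)" for x
    using AB by (simp add: fun_eq_iff)
  have A_pow_B': "(A ^^ n) (hadjoint B x) = hadjoint B ((A ^^ n) x)" for n x
    by (rule funpow_commute_apply) (rule AB')
  have A_B_pow: "A ((B ^^ n) x) = (B ^^ n) (A x)" for n x
    by (rule funpow_commute_apply[symmetric]) (rule AB_apply[symmetric])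
  have A_pow_B_pow: "(A ^^ n) ((B ^^ p) x) = (B ^^ p) ((A ^^ n) x)" for n p x
    by (rule funpow_commute_apply) (rule A_B_pow)
  have qA: "norm (hadjoint A ((A ^^ k) x)) \<le> norm (A ((A ^^ k) x))" for x
    using \<open>quasihyponormal k A\<close> quasihyponormal_iff_norm_le[OF A] by blast
  have qB: "norm (hadjoint B ((B ^^ k) x)) \<le> norm (B ((B ^^ k) x))" for x
    using \<open>quasihyponormal k B\<close> quasihyponormal_iff_norm_le[OF B] by blast
  have "norm (hadjoint (A \<circ> B) (((A \<circ> B) ^^ k) x)) \<le> norm ((A \<circ> B) (((A \<circ> B) ^^ k) x))" for x
  proof -
    \<comment> \<open>writing the product as \<open>B A\<close> puts \<open>A\<^sup>*\<close> outermost in its adjoint\<close>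
    have adj: "hadjoint (A \<circ> B) = hadjoint A \<circ> hadjoint B"
      unfolding AB by (rule hadjoint_comp[OF B A])
    have pow: "((A \<circ> B) ^^ k) x = (A ^^ k) ((B ^^ k) x)"
      by (rule funpow_comp_apply) (rule AB_apply)
    have "hadjoint (A \<circ> B) (((A \<circ> B) ^^ k) x) = hadjoint A ((A ^^ k) (hadjoint B ((B ^^ k) x)))"
      by (simp add: adj pow A_pow_B')
    then have "norm (hadjoint (A \<circ> B) (((A \<circ> B) ^^ k) x))
        \<le> norm (A ((A ^^ k) (hadjoint B ((B ^^ k) x))))"
      using qA by simp
    also have "\<dots> = norm (hadjoint B ((B ^^ k) (A ((A ^^ k) x))))"
      by (simp add: A_pow_B' AB' A_pow_B_pow A_B_pow)
    also have "\<dots> \<le> norm (B ((B ^^ k) (A ((A ^^ k) x))))"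
      by (rule qB)
    also have "\<dots> = norm ((A \<circ> B) (((A \<circ> B) ^^ k) x))"
      by (simp only: pow comp_apply AB_apply A_pow_B_pow A_B_pow)
    finally show ?thesis .
  qed
  then show ?thesis
    using quasihyponormal_iff_norm_le[OF bounded_clinear_comp[OF A B]] by blast
qed

end
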